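(* Let $d\in\mathbb{N}$, let $H$ be a Hilbert space, $U$ a unitary operator on $H\otimes\mathbb{C}^d$, $A=(a_{jk})$ an element of the Hilbert space $H\otimes\mathcal{M}_d(\mathbb{C})$, and $\lambda=(\lambda_{jk})\in\mathcal{M}_d(\mathbb{C})$ a hermitian matrix. Then there exists a unique Schürmann triple $(\rho,\eta,L)$ on $\mathcal{U}_d$ over $H$ such that $$\rho(u_{jk})=P_jUP_k^*,\qquad\eta(u_{jk})=a_{jk},\qquad L(u_{jk}-u_{kj}^* )=2i\lambda_{jk}$$ for $j,k=1,\ldots,d$, where $P_j:H\otimes\mathbb{C}^d\to H\otimes\mathbb{C}e_j\cong H$ projects a vector with entries in $H$ to its $j$-th component. Furthermore, all Schürmann triples on $\mathcal{U}_d$ are of this form.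
   Context: $\mathcal{U}_d$ is the complex unital $*$-algebra generated by non-commuting indeterminates $u_{ij},u_{ij}^*$, $i,j=1,\ldots,d$, with relations $\sum_ju_{kj}u_{\ell j}^*=\delta_{k\ell}\mathbf{1}=\sum_ju_{jk}^*u_{j\ell}$, with counit the $*$-homomorphism $\varepsilon:\mathcal{U}_d\to\mathbb{C}$, $\varepsilon(u_{k\ell})=\delta_{k\ell}$. $e_1,\ldots,e_d$ is the standard basis of $\mathbb{C}^d$; $a_{jk}\in H$ are the components of $A$. A Schürmann triple on $\mathcal{U}_d$ over a (pre-)Hilbert space $D$ is a triple $(\rho,\eta,L)$ of a unital $*$-representation $\rho$ of $\mathcal{U}_d$ by adjointable operators on $D$, a linear map $\eta:\mathcal{U}_d\to D$ with $\eta(ab)=\rho(a)\eta(b)+\eta(a)\varepsilon(b)$, and a hermitian linear functional $L:\mathcal{U}_d\to\mathbb{C}$ with $-\langle\eta(a^* ),\eta(b)\rangle=\varepsilon(a)L(b)-L(ab)+L(a)\varepsilon(b)$ for all $a,b\in\mathcal{U}_d$. Because of the relations of $\mathcal{U}_d$ the operators $\rho(u_{jk})$ are automatically bounded, so a Schürmann triple over a pre-Hilbert space $D$ is identified with its extension to the completion of $D$. *)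

theory Defs
  imports "HOL-Analysis.Analysis"
begin

section \<open>Complex vector spaces, (pre-)Hilbert spaces and *-algebras\<close>

class scaleC =
  fixes scaleC :: "complex \<Rightarrow> 'a \<Rightarrow> 'a" (infixr "*\<^sub>C" 75)

class complex_vector = scaleC + ab_group_add +
  assumes scaleC_add_right: "c *\<^sub>C (x + y) = c *\<^sub>C x + c *\<^sub>C y"
    and scaleC_add_left: "(b + c) *\<^sub>C x = b *\<^sub>C x + c *\<^sub>C x"
    and scaleC_scaleC: "b *\<^sub>C c *\<^sub>C x = (b * c) *\<^sub>C x"
    and scaleC_one: "1 *\<^sub>C x = x"

definition clinear :: "('a::complex_vector \<Rightarrow> 'b::complex_vector) \<Rightarrow> bool" where
  "clinear f \<longleftrightarrow> (\<forall>x y. f (x + y) = f x + f y) \<and> (\<forall>c x. f (c *\<^sub>C x) = c *\<^sub>C f x)"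

class cinner =
  fixes cinner :: "'a \<Rightarrow> 'a \<Rightarrow> complex"

text \<open>Pre-Hilbert spaces. The inner product is linear in the second argument; metric, topology and
  uniformity are those of the induced norm.\<close>

class complex_inner = complex_vector + real_normed_vector + cinner +
  assumes scaleR_scaleC: "r *\<^sub>R x = complex_of_real r *\<^sub>C x"
    and cinner_commute: "cinner x y = cnj (cinner y x)"
    and cinner_add_right: "cinner x (y + z) = cinner x y + cinner x z"
    and cinner_scaleC_right: "cinner x (c *\<^sub>C y) = c * cinner x y"
    and cinner_self: "cinner x x = complex_of_real ((norm x)\<^sup>2)"

class complex_hilbert = complex_inner + complete_space

class star =
  fixes star :: "'a \<Rightarrow> 'a" ("_\<^sup>\<star>" [1000] 999)

class complex_star_algebra = complex_vector + ring + monoid_mult + star +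
  assumes mult_scaleC_left: "(c *\<^sub>C a) * b = c *\<^sub>C (a * b)"
    and mult_scaleC_right: "a * (c *\<^sub>C b) = c *\<^sub>C (a * b)"
    and star_add: "(a + b)\<^sup>\<star> = a\<^sup>\<star> + b\<^sup>\<star>"
    and star_scaleC: "(c *\<^sub>C a)\<^sup>\<star> = cnj c *\<^sub>C a\<^sup>\<star>"
    and star_mult: "(a * b)\<^sup>\<star> = b\<^sup>\<star> * a\<^sup>\<star>"
    and star_star: "(a\<^sup>\<star>)\<^sup>\<star> = a"

definition star_hom :: "('a::complex_star_algebra \<Rightarrow> 'b::complex_star_algebra) \<Rightarrow> bool" where
  "star_hom f \<longleftrightarrow> clinear f \<and> f 1 = 1 \<and> (\<forall>a b. f (a * b) = f a * f b) \<and> (\<forall>a. f (a\<^sup>\<star>) = (f a)\<^sup>\<star>)"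

instantiation complex :: complex_star_algebra
begin
definition scaleC_complex :: "complex \<Rightarrow> complex \<Rightarrow> complex" where
  "scaleC_complex c x = c * x"
definition star_complex :: "complex \<Rightarrow> complex" where
  "star_complex x = cnj x"
instance
  by standard (auto simp: scaleC_complex_def star_complex_def algebra_simps)
end

text \<open>The Hilbert space \<open>H \<otimes> \<complex>\<^sup>d\<close> is the type \<open>'h ^ 'd\<close> of \<open>'d\<close>-indexed families of vectors of \<open>H\<close>;
  the norm on \<open>'h ^ 'd\<close> provided by the library is the one of the inner product defined here.\<close>

instantiation vec :: (complex_inner, finite) complex_inner
begin
definition scaleC_vec :: "complex \<Rightarrow> 'a ^ 'b \<Rightarrow> 'a ^ 'b" where
  "scaleC_vec c x = (\<chi> i. c *\<^sub>C (x $ i))"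
definition cinner_vec :: "'a ^ 'b \<Rightarrow> 'a ^ 'b \<Rightarrow> complex" where
  "cinner_vec x y = (\<Sum>i\<in>UNIV. cinner (x $ i) (y $ i))"
instance
proof
  fix b c :: complex and r :: real and x y z :: "'a ^ 'b"
  show "c *\<^sub>C (x + y) = c *\<^sub>C x + c *\<^sub>C y"
    by (simp add: scaleC_vec_def vec_eq_iff scaleC_add_right)
  show "(b + c) *\<^sub>C x = b *\<^sub>C x + c *\<^sub>C x"
    by (simp add: scaleC_vec_def vec_eq_iff scaleC_add_left)
  show "b *\<^sub>C c *\<^sub>C x = (b * c) *\<^sub>C x"
    by (simp add: scaleC_vec_def vec_eq_iff scaleC_scaleC)
  show "1 *\<^sub>C x = x"
    by (simp add: scaleC_vec_def vec_eq_iff scaleC_one)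
  show "r *\<^sub>R x = complex_of_real r *\<^sub>C x"
    by (simp add: scaleC_vec_def vec_eq_iff scaleR_scaleC)
  show "cinner x y = cnj (cinner y x)"
    unfolding cinner_vec_def cnj_sum by (rule sum.cong[OF refl]) (rule cinner_commute)
  show "cinner x (y + z) = cinner x y + cinner x z"
    by (simp add: cinner_vec_def cinner_add_right sum.distrib)
  show "cinner x (c *\<^sub>C y) = c * cinner x y"
    by (simp add: cinner_vec_def scaleC_vec_def cinner_scaleC_right sum_distrib_left)
  show "cinner x x = complex_of_real ((norm x)\<^sup>2)"
    by (simp add: cinner_vec_def cinner_self norm_vec_def L2_set_def sum_nonneg)
qed
end

instance vec :: (complex_hilbert, finite) complex_hilbert ..


section \<open>Operators\<close>

definition is_adjoint :: "('a::complex_inner \<Rightarrow> 'b::complex_inner) \<Rightarrow> ('b \<Rightarrow> 'a) \<Rightarrow> bool" where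
  "is_adjoint T S \<longleftrightarrow> (\<forall>x y. cinner (S y) x = cinner y (T x))"

definition adjointable :: "('a::complex_inner \<Rightarrow> 'b::complex_inner) \<Rightarrow> bool" where
  "adjointable T \<longleftrightarrow> clinear T \<and> (\<exists>S. is_adjoint T S)"

definition adj :: "('a::complex_inner \<Rightarrow> 'b::complex_inner) \<Rightarrow> ('b \<Rightarrow> 'a)" where
  "adj T = (THE S. is_adjoint T S)"

definition unitary :: "('a::complex_inner \<Rightarrow> 'a) \<Rightarrow> bool" where
  "unitary T \<longleftrightarrow> adjointable T \<and> adj T \<circ> T = id \<and> T \<circ> adj T = id"

definition hermitian :: "complex ^ 'd ^ 'd \<Rightarrow> bool" where
  "hermitian M \<longleftrightarrow> (\<forall>j k. M $ k $ j = cnj (M $ j $ k))"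

definition star_representation ::
    "('a::complex_star_algebra \<Rightarrow> ('h::complex_inner \<Rightarrow> 'h)) \<Rightarrow> bool" where
  "star_representation \<rho> \<longleftrightarrow>
     (\<forall>a. adjointable (\<rho> a)) \<and>
     (\<forall>a b. \<rho> (a + b) = (\<lambda>x. \<rho> a x + \<rho> b x)) \<and>
     (\<forall>c a. \<rho> (c *\<^sub>C a) = (\<lambda>x. c *\<^sub>C \<rho> a x)) \<and>
     \<rho> 1 = id \<and>
     (\<forall>a b. \<rho> (a * b) = \<rho> a \<circ> \<rho> b) \<and>
     (\<forall>a. \<rho> (a\<^sup>\<star>) = adj (\<rho> a))"

definition is_completion :: "('p::complex_inner \<Rightarrow> 'h::complex_hilbert) \<Rightarrow> bool" where
  "is_completion \<iota> \<longleftrightarrow>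
     clinear \<iota> \<and> (\<forall>x y. cinner (\<iota> x) (\<iota> y) = cinner x y) \<and> closure (range \<iota>) = UNIV"

lemma cinner_ext:
  fixes x y :: "'a::complex_inner"
  assumes "\<And>z. cinner x z = cinner y z"
  shows "x = y"
proof -
  have "cinner z (x - y) = 0" for z
  proof -
    have "cinner z x = cinner z y"
      using assms[of z] cinner_commute[of z x] cinner_commute[of z y] by simp
    moreover have "cinner z x = cinner z (x - y) + cinner z y"
      using cinner_add_right[of z "x - y" y] by simp
    ultimately show ?thesis by simp
  qed
  from this[of "x - y"] show ?thesis
    by (simp add: cinner_self)
qed

lemma adj_eqI:
  assumes S: "is_adjoint T S"
  shows "adj T = S"
  unfolding adj_def
proof (rule the_equality, rule S)
  fix R assume R: "is_adjoint T R"
  show "R = S"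
  proof
    fix y
    have "cinner (R y) z = cinner (S y) z" for z
      using R S unfolding is_adjoint_def by metis
    then show "R y = S y" by (rule cinner_ext)
  qed
qed

lemma is_adjoint_adj:
  assumes "adjointable T"
  shows "is_adjoint T (adj T)"
proof -
  obtain S where "is_adjoint T S"
    using assms unfolding adjointable_def by blast
  then show ?thesis using adj_eqI[of T S] by simp
qed

definition proj :: "'d \<Rightarrow> 'h ^ 'd \<Rightarrow> 'h" where
  "proj j v = v $ j"

lemma is_adjoint_proj:
  "is_adjoint (proj j :: 'h::complex_inner ^ 'd::finite \<Rightarrow> 'h) (axis j)"
proof -
  have "cinner (0::'h) z = 0" for z
    using cinner_add_right[of z 0 0] cinner_commute[of 0 z] by simp
  then have "cinner (axis j y $ i) (x $ i) = (if i = j then cinner y (x $ i) else 0)"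
    for x :: "'h ^ 'd" and y i
    by (simp add: axis_def)
  then show ?thesis
    by (simp add: is_adjoint_def proj_def cinner_vec_def)
qed

lemma adj_proj: "adj (proj j :: 'h::complex_inner ^ 'd::finite \<Rightarrow> 'h) = axis j"
  by (rule adj_eqI[OF is_adjoint_proj])


section \<open>The algebra \<open>\<U>\<^sub>d\<close>\<close>

text \<open>The *-algebra with generators \<open>u\<^sub>j\<^sub>k\<close> (indices ranging over a finite type \<open>'d\<close>) is
  presented in the usual way: formal *-algebra expressions in the generators modulo the least
  congruence containing the axioms of complex unital *-algebras and the unitarity relations.
  The indeterminate \<open>u\<^sub>j\<^sub>k\<^sup>*\<close> is the expression \<open>TStar (TGen j k)\<close>.\<close>

datatype 'd uterm =
    TGen 'd 'd
  | TZero
  | TOne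
  | TAdd "'d uterm" "'d uterm"
  | TScale complex "'d uterm"
  | TMult "'d uterm" "'d uterm"
  | TStar "'d uterm"

text \<open>Formal expressions have no commutative addition, so sums over the index type are formed along
  an enumeration of it; all enumerations give congruent expressions.\<close>

definition tsum :: "('d \<Rightarrow> 'd uterm) \<Rightarrow> 'd list \<Rightarrow> 'd uterm" where
  "tsum f js = foldr (\<lambda>j t. TAdd (f j) t) js TZero"

inductive ucong :: "'d uterm \<Rightarrow> 'd uterm \<Rightarrow> bool" where
  uc_refl: "ucong a a"
| uc_sym: "ucong a b \<Longrightarrow> ucong b a"
| uc_trans: "ucong a b \<Longrightarrow> ucong b c \<Longrightarrow> ucong a c"
| uc_cong_add: "ucong a a' \<Longrightarrow> ucong b b' \<Longrightarrow> ucong (TAdd a b) (TAdd a' b')"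
| uc_cong_scale: "ucong a a' \<Longrightarrow> ucong (TScale x a) (TScale x a')"
| uc_cong_mult: "ucong a a' \<Longrightarrow> ucong b b' \<Longrightarrow> ucong (TMult a b) (TMult a' b')"
| uc_cong_star: "ucong a a' \<Longrightarrow> ucong (TStar a) (TStar a')"
| uc_add_assoc: "ucong (TAdd (TAdd a b) c) (TAdd a (TAdd b c))"
| uc_add_commute: "ucong (TAdd a b) (TAdd b a)"
| uc_add_zero: "ucong (TAdd TZero a) a"
| uc_add_inverse: "ucong (TAdd (TScale (-1) a) a) TZero"
| uc_scale_add_right: "ucong (TScale x (TAdd a b)) (TAdd (TScale x a) (TScale x b))"
| uc_scale_add_left: "ucong (TScale (x + y) a) (TAdd (TScale x a) (TScale y a))"
| uc_scale_scale: "ucong (TScale x (TScale y a)) (TScale (x * y) a)"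
| uc_scale_one: "ucong (TScale 1 a) a"
| uc_mult_assoc: "ucong (TMult (TMult a b) c) (TMult a (TMult b c))"
| uc_mult_one_left: "ucong (TMult TOne a) a"
| uc_mult_one_right: "ucong (TMult a TOne) a"
| uc_distrib_right: "ucong (TMult (TAdd a b) c) (TAdd (TMult a c) (TMult b c))"
| uc_distrib_left: "ucong (TMult a (TAdd b c)) (TAdd (TMult a b) (TMult a c))"
| uc_mult_scale_left: "ucong (TMult (TScale x a) b) (TScale x (TMult a b))"
| uc_mult_scale_right: "ucong (TMult a (TScale x b)) (TScale x (TMult a b))"
| uc_star_add: "ucong (TStar (TAdd a b)) (TAdd (TStar a) (TStar b))"
| uc_star_scale: "ucong (TStar (TScale x a)) (TScale (cnj x) (TStar a))"
| uc_star_mult: "ucong (TStar (TMult a b)) (TMult (TStar b) (TStar a))"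
| uc_star_star: "ucong (TStar (TStar a)) a"
| uc_unitarity_left: "distinct js \<Longrightarrow> set js = UNIV \<Longrightarrow>
    ucong (tsum (\<lambda>j. TMult (TGen k j) (TStar (TGen l j))) js) (if k = l then TOne else TZero)"
| uc_unitarity_right: "distinct js \<Longrightarrow> set js = UNIV \<Longrightarrow>
    ucong (tsum (\<lambda>j. TMult (TStar (TGen j k)) (TGen j l)) js) (if k = l then TOne else TZero)"

lemma equivp_ucong: "equivp ucong"
  by (rule equivpI)
     (auto simp: reflp_def symp_def transp_def intro: uc_refl uc_sym uc_trans)

quotient_type 'd U_alg = "'d uterm" / ucong
  by (rule equivp_ucong)

instantiation U_alg :: (type) complex_star_algebra
begin

lift_definition zero_U_alg :: "'a U_alg" is TZero .
lift_definition one_U_alg :: "'a U_alg" is TOne .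
lift_definition plus_U_alg :: "'a U_alg \<Rightarrow> 'a U_alg \<Rightarrow> 'a U_alg" is TAdd
  by (rule uc_cong_add)
lift_definition uminus_U_alg :: "'a U_alg \<Rightarrow> 'a U_alg" is "TScale (-1)"
  by (rule uc_cong_scale)
definition minus_U_alg :: "'a U_alg \<Rightarrow> 'a U_alg \<Rightarrow> 'a U_alg" where
  "minus_U_alg a b = a + - b"
lift_definition times_U_alg :: "'a U_alg \<Rightarrow> 'a U_alg \<Rightarrow> 'a U_alg" is TMult
  by (rule uc_cong_mult)
lift_definition scaleC_U_alg :: "complex \<Rightarrow> 'a U_alg \<Rightarrow> 'a U_alg" is TScale
  by (rule uc_cong_scale)
lift_definition star_U_alg :: "'a U_alg \<Rightarrow> 'a U_alg" is TStar
  by (rule uc_cong_star)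

instance
proof
  fix a b c :: "'a U_alg" and x y :: complex
  show "a + b + c = a + (b + c)" by transfer (rule uc_add_assoc)
  show "a + b = b + a" by transfer (rule uc_add_commute)
  show "0 + a = a" by transfer (rule uc_add_zero)
  show "- a + a = 0" by transfer (rule uc_add_inverse)
  show "a - b = a + - b" by (rule minus_U_alg_def)
  show "x *\<^sub>C (a + b) = x *\<^sub>C a + x *\<^sub>C b" by transfer (rule uc_scale_add_right)
  show "(x + y) *\<^sub>C a = x *\<^sub>C a + y *\<^sub>C a" by transfer (rule uc_scale_add_left)
  show "x *\<^sub>C y *\<^sub>C a = (x * y) *\<^sub>C a" by transfer (rule uc_scale_scale)
  show "1 *\<^sub>C a = a" by transfer (rule uc_scale_one)
  show "a * b * c = a * (b * c)" by transfer (rule uc_mult_assoc)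
  show "1 * a = a" by transfer (rule uc_mult_one_left)
  show "a * 1 = a" by transfer (rule uc_mult_one_right)
  show "(a + b) * c = a * c + b * c" by transfer (rule uc_distrib_right)
  show "a * (b + c) = a * b + a * c" by transfer (rule uc_distrib_left)
  show "(x *\<^sub>C a) * b = x *\<^sub>C (a * b)" by transfer (rule uc_mult_scale_left)
  show "a * (x *\<^sub>C b) = x *\<^sub>C (a * b)" by transfer (rule uc_mult_scale_right)
  show "(a + b)\<^sup>\<star> = a\<^sup>\<star> + b\<^sup>\<star>" by transfer (rule uc_star_add)
  show "(x *\<^sub>C a)\<^sup>\<star> = cnj x *\<^sub>C a\<^sup>\<star>" by transfer (rule uc_star_scale)
  show "(a * b)\<^sup>\<star> = b\<^sup>\<star> * a\<^sup>\<star>" by transfer (rule uc_star_mult)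
  show "(a\<^sup>\<star>)\<^sup>\<star> = a" by transfer (rule uc_star_star)
qed

end

lift_definition ugen :: "'d \<Rightarrow> 'd \<Rightarrow> 'd U_alg" is TGen .

definition unitary_matrix :: "('d::finite \<Rightarrow> 'd \<Rightarrow> 'a::complex_star_algebra) \<Rightarrow> bool" where
  "unitary_matrix v \<longleftrightarrow> (\<forall>k l.
     (\<Sum>j\<in>UNIV. v k j * (v l j)\<^sup>\<star>) = (if k = l then 1 else 0) \<and>
     (\<Sum>j\<in>UNIV. (v j k)\<^sup>\<star> * v j l) = (if k = l then 1 else 0))"

lemma abs_tsum: "abs_U_alg (tsum f js) = (\<Sum>j\<leftarrow>js. abs_U_alg (f j))"
  by (induction js) (simp_all add: tsum_def zero_U_alg.abs_eq plus_U_alg.abs_eq[symmetric])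

lemma unitary_matrix_u: "unitary_matrix (ugen :: 'd::finite \<Rightarrow> 'd \<Rightarrow> 'd U_alg)"
proof -
  obtain js :: "'d list" where js: "set js = UNIV" "distinct js"
    using finite_distinct_list[OF finite] by blast
  have sum: "(\<Sum>j\<in>UNIV. abs_U_alg (f j)) = abs_U_alg (tsum f js)" for f :: "'d \<Rightarrow> 'd uterm"
    using sum_list_distinct_conv_sum_set[OF js(2), of "\<lambda>j. abs_U_alg (f j)"] js(1)
    by (simp add: abs_tsum)
  show ?thesis
    unfolding unitary_matrix_def
  proof (intro allI conjI)
    fix k l :: 'd
    have "(\<Sum>j\<in>UNIV. ugen k j * (ugen l j)\<^sup>\<star>)
        = abs_U_alg (tsum (\<lambda>j. TMult (TGen k j) (TStar (TGen l j))) js)"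
      by (simp add: sum[symmetric] ugen.abs_eq times_U_alg.abs_eq star_U_alg.abs_eq)
    also have "\<dots> = abs_U_alg (if k = l then TOne else TZero)"
      using uc_unitarity_left[OF js(2,1)] by (simp add: U_alg.abs_eq_iff)
    finally show "(\<Sum>j\<in>UNIV. ugen k j * (ugen l j)\<^sup>\<star>) = (if k = l then 1 else 0)"
      by (simp add: zero_U_alg.abs_eq one_U_alg.abs_eq)
    have "(\<Sum>j\<in>UNIV. (ugen j k)\<^sup>\<star> * ugen j l)
        = abs_U_alg (tsum (\<lambda>j. TMult (TStar (TGen j k)) (TGen j l)) js)"
      by (simp add: sum[symmetric] ugen.abs_eq times_U_alg.abs_eq star_U_alg.abs_eq)
    also have "\<dots> = abs_U_alg (if k = l then TOne else TZero)"
      using uc_unitarity_right[OF js(2,1)] by (simp add: U_alg.abs_eq_iff)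
    finally show "(\<Sum>j\<in>UNIV. (ugen j k)\<^sup>\<star> * ugen j l) = (if k = l then 1 else 0)"
      by (simp add: zero_U_alg.abs_eq one_U_alg.abs_eq)
  qed
qed

primrec teval :: "('d \<Rightarrow> 'd \<Rightarrow> 'a::complex_star_algebra) \<Rightarrow> 'd uterm \<Rightarrow> 'a" where
  "teval v (TGen j k) = v j k"
| "teval v TZero = 0"
| "teval v TOne = 1"
| "teval v (TAdd a b) = teval v a + teval v b"
| "teval v (TScale c a) = c *\<^sub>C teval v a"
| "teval v (TMult a b) = teval v a * teval v b"
| "teval v (TStar a) = (teval v a)\<^sup>\<star>"

lemma scaleC_zero_right: "c *\<^sub>C 0 = (0::'a::complex_vector)"
  using scaleC_add_right[of c "0::'a" 0] by simp

lemma scaleC_zero_left: "0 *\<^sub>C x = (0::'a::complex_vector)"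
  using scaleC_add_left[of 0 0 x] by simp

lemma scaleC_minus_one: "(-1) *\<^sub>C x = - (x::'a::complex_vector)"
  using scaleC_add_left[of "-1" 1 x]
  by (simp add: scaleC_zero_left scaleC_one eq_neg_iff_add_eq_0)

lemma star_zero: "0\<^sup>\<star> = (0::'a::complex_star_algebra)"
  using star_add[of "0::'a" 0] by simp

lemma star_one: "1\<^sup>\<star> = (1::'a::complex_star_algebra)"
  using star_mult[of "1\<^sup>\<star>::'a" 1] by (simp add: star_star)

lemma teval_tsum: "teval v (tsum f js) = (\<Sum>j\<leftarrow>js. teval v (f j))"
  by (induction js) (simp_all add: tsum_def)

lemma teval_ucong:
  fixes v :: "'d::finite \<Rightarrow> 'd \<Rightarrow> 'a::complex_star_algebra"
  assumes v: "unitary_matrix v" and ab: "ucong a b"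
  shows "teval v a = teval v b"
  using ab
proof induction
  case (uc_unitarity_left js k l)
  then show ?case
    using v by (simp add: teval_tsum sum_list_distinct_conv_sum_set unitary_matrix_def)
next
  case (uc_unitarity_right js k l)
  then show ?case
    using v by (simp add: teval_tsum sum_list_distinct_conv_sum_set unitary_matrix_def)
qed (simp_all add: scaleC_add_right scaleC_add_left scaleC_scaleC scaleC_one scaleC_minus_one
      mult_scaleC_left mult_scaleC_right star_add star_scaleC star_mult star_star
      algebra_simps)

theorem U_alg_universal:
  fixes v :: "'d::finite \<Rightarrow> 'd \<Rightarrow> 'a::complex_star_algebra"
  assumes v: "unitary_matrix v"
  shows "\<exists>!f. star_hom f \<and> (\<forall>j k. f (ugen j k) = v j k)"
proof (rule ex1I)
  let ?f = "\<lambda>a. teval v (rep_U_alg a)"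
  have f: "?f (abs_U_alg t) = teval v t" for t
    by (rule teval_ucong[OF v]) (rule Quotient3_rep_abs[OF Quotient3_U_alg], rule uc_refl)
  have "?f (a + b) = ?f a + ?f b" "?f (c *\<^sub>C a) = c *\<^sub>C ?f a" "?f (a * b) = ?f a * ?f b"
    "?f (a\<^sup>\<star>) = (?f a)\<^sup>\<star>" for a b c
    by (induct a rule: U_alg.abs_induct; induct b rule: U_alg.abs_induct;
        simp add: f plus_U_alg.abs_eq scaleC_U_alg.abs_eq times_U_alg.abs_eq star_U_alg.abs_eq)+
  then show "star_hom ?f \<and> (\<forall>j k. ?f (ugen j k) = v j k)"
    by (simp add: star_hom_def clinear_def f one_U_alg.abs_eq ugen.abs_eq)
  fix g :: "'d U_alg \<Rightarrow> 'a"
  assume g: "star_hom g \<and> (\<forall>j k. g (ugen j k) = v j k)"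
  have g_abs: "g (abs_U_alg t) = teval v t" for t
  proof (induction t)
    case TZero
    have "g 0 = 0"
      using g unfolding star_hom_def clinear_def by (metis add_cancel_right_right)
    then show ?case by (simp add: zero_U_alg.abs_eq)
  qed (use g in \<open>simp_all add: star_hom_def clinear_def one_U_alg.abs_eq[symmetric]
        ugen.abs_eq[symmetric] plus_U_alg.abs_eq[symmetric] scaleC_U_alg.abs_eq[symmetric]
        times_U_alg.abs_eq[symmetric] star_U_alg.abs_eq[symmetric]\<close>)
  show "g = ?f"
  proof
    fix a show "g a = ?f a"
      by (induct a rule: U_alg.abs_induct) (simp only: f g_abs)
  qed
qed

definition counit :: "'d::finite U_alg \<Rightarrow> complex" where
  "counit = (THE f. star_hom f \<and> (\<forall>k l. f (ugen k l) = (if k = l then 1 else 0)))"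

lemma counit:
  fixes k l :: "'d::finite"
  shows "star_hom (counit :: 'd U_alg \<Rightarrow> complex)"
    and "counit (ugen k l) = (if k = l then 1 else 0)"
proof -
  have "unitary_matrix (\<lambda>k l :: 'd::finite. if k = l then 1 else 0 :: complex)"
    by (auto simp: unitary_matrix_def star_complex_def if_distrib[of "\<lambda>x. x * _"]
        if_distrib[of cnj] cong: if_cong)
  from theI'[OF U_alg_universal[OF this]]
  show "star_hom (counit :: 'd U_alg \<Rightarrow> complex)" "counit (ugen k l) = (if k = l then 1 else 0)"
    unfolding counit_def by blast+
qed


section \<open>Schuermann triples\<close>

definition schuermann_triple ::
    "('d::finite U_alg \<Rightarrow> ('h::complex_inner \<Rightarrow> 'h)) \<Rightarrow> ('d U_alg \<Rightarrow> 'h) \<Rightarrow> ('d U_alg \<Rightarrow> complex)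
      \<Rightarrow> bool" where
  "schuermann_triple \<rho> \<eta> L \<longleftrightarrow>
     star_representation \<rho> \<and>
     clinear \<eta> \<and> (\<forall>a b. \<eta> (a * b) = \<rho> a (\<eta> b) + counit b *\<^sub>C \<eta> a) \<and>
     clinear L \<and> (\<forall>a. L (a\<^sup>\<star>) = cnj (L a)) \<and>
     (\<forall>a b. - cinner (\<eta> (a\<^sup>\<star>)) (\<eta> b) = counit a * L b - L (a * b) + L a * counit b)"

definition has_parameters ::
    "('d::finite U_alg \<Rightarrow> ('h::complex_inner \<Rightarrow> 'h)) \<Rightarrow> ('d U_alg \<Rightarrow> 'h) \<Rightarrow> ('d U_alg \<Rightarrow> complex)
      \<Rightarrow> ('h ^ 'd \<Rightarrow> 'h ^ 'd) \<Rightarrow> 'h ^ 'd ^ 'd \<Rightarrow> complex ^ 'd ^ 'd \<Rightarrow> bool" where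
  "has_parameters \<rho> \<eta> L U A \<Lambda> \<longleftrightarrow> (\<forall>j k.
     \<rho> (ugen j k) = proj j \<circ> U \<circ> adj (proj k) \<and>
     \<eta> (ugen j k) = A $ j $ k \<and>
     L (ugen j k - (ugen k j)\<^sup>\<star>) = 2 * \<i> * \<Lambda> $ j $ k)"

text \<open>The triple \<open>(\<rho>', \<eta>', L)\<close> over a completion \<open>\<iota>\<close> extends the triple \<open>(\<rho>, \<eta>, L)\<close>; the
  functional is not affected.\<close>

definition extends_along ::
    "('p \<Rightarrow> 'h) \<Rightarrow> ('a \<Rightarrow> 'p \<Rightarrow> 'p) \<Rightarrow> ('a \<Rightarrow> 'p) \<Rightarrow> ('a \<Rightarrow> 'h \<Rightarrow> 'h) \<Rightarrow> ('a \<Rightarrow> 'h) \<Rightarrow> bool" where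
  "extends_along \<iota> \<rho> \<eta> \<rho>' \<eta>' \<longleftrightarrow>
     (\<forall>a x. \<rho>' a (\<iota> x) = \<iota> (\<rho> a x)) \<and> (\<forall>a. \<eta>' a = \<iota> (\<eta> a))"

end

theory Submission
  imports Defs
begin

text \<open>A Schuermann triple \<open>(\<rho>, \<eta>, L)\<close> is the same thing as a *-homomorphism
  \<open>a \<mapsto> [[\<epsilon> a, \<langle>\<eta> (a\<^sup>*), \<cdot>\<rangle>, L a], [0, \<rho> a, \<eta> a], [0, 0, \<epsilon> a]]\<close> from the algebra into upper triangular
  block operators on \<open>\<complex> \<oplus> H \<oplus> \<complex>\<close>, with the involution of the indefinite inner product that pairs
  the two copies of \<open>\<complex>\<close>. By the universal property such homomorphisms correspond to unitary
  matrices over this block algebra. The unitarity relations determine the first row of the matrix,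
  except for the hermitian parameter \<open>\<Lambda>\<close>, from the remaining entries, so existence and uniqueness
  both follow. Over a pre-Hilbert space each \<open>\<rho> (u\<^sub>j\<^sub>k)\<close> is a block of a unitary operator, hence a
  contraction, and the triple extends to the completion by continuity.\<close>

section \<open>Adjoints\<close>

lemma cinner_add_left: "cinner (x + y) z = cinner x z + cinner (y :: 'a::complex_inner) z"
  by (metis cinner_add_right cinner_commute complex_cnj_add)

lemma cinner_scaleC_left: "cinner (c *\<^sub>C x) y = cnj c * cinner (x :: 'a::complex_inner) y"
  by (metis cinner_scaleC_right cinner_commute complex_cnj_mult)

lemma cnj_cinner: "cnj (cinner x y) = cinner y (x :: 'a::complex_inner)"
  by (metis cinner_commute)

lemma cinner_zero_left: "cinner (0 :: 'a::complex_inner) x = 0"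
  using cinner_add_left[of 0 0 x] by simp

lemma cinner_zero_right: "cinner (x :: 'a::complex_inner) 0 = 0"
  using cinner_add_right[of x 0 0] by simp

lemma cinner_minus_left: "cinner (- x) y = - cinner (x :: 'a::complex_inner) y"
  using cinner_scaleC_left[of "-1" x y] by (simp add: scaleC_minus_one)

lemma cinner_minus_right: "cinner x (- y) = - cinner (x :: 'a::complex_inner) y"
  using cinner_scaleC_right[of x "-1" y] by (simp add: scaleC_minus_one)

lemma cinner_sum_left: "cinner (sum f I) y = (\<Sum>i\<in>I. cinner (f i :: 'a::complex_inner) y)"
  by (induction I rule: infinite_finite_induct) (simp_all add: cinner_zero_left cinner_add_left)

lemma cinner_sum_right: "cinner y (sum f I) = (\<Sum>i\<in>I. cinner y (f i :: 'a::complex_inner))"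
  by (induction I rule: infinite_finite_induct) (simp_all add: cinner_zero_right cinner_add_right)

lemma clinear_zero: "clinear f \<Longrightarrow> f 0 = 0"
  unfolding clinear_def by (metis add_cancel_right_right)

lemma clinear_minus: "clinear f \<Longrightarrow> f (- x) = - f x"
  unfolding clinear_def by (metis scaleC_minus_one)

lemma clinear_diff: "clinear f \<Longrightarrow> f (x - y) = f x - f y"
  using clinear_minus[of f y] unfolding clinear_def
  by (metis add_uminus_conv_diff)

lemma clinear_sum: "clinear f \<Longrightarrow> f (sum g I) = (\<Sum>i\<in>I. f (g i))"
  by (induction I rule: infinite_finite_induct) (auto simp: clinear_zero clinear_def)

lemma is_adjoint_sym: "is_adjoint T S \<Longrightarrow> is_adjoint S T"
  unfolding is_adjoint_def by (metis cinner_commute)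

lemma cinner_ext_right:
  fixes x y :: "'a::complex_inner"
  assumes "\<And>z. cinner z x = cinner z y"
  shows "x = y"
  using assms by (metis cinner_commute cinner_ext)

lemma is_adjoint_clinear:
  assumes "is_adjoint T S"
  shows "clinear T"
proof -
  have "cinner z (T x) = cinner (S z) x" for x z
    using assms by (simp add: is_adjoint_def)
  then show ?thesis
    unfolding clinear_def
    by (intro conjI allI; intro cinner_ext_right) (simp_all add: cinner_add_right cinner_scaleC_right)
qed

lemma is_adjoint_adjointable: "is_adjoint T S \<Longrightarrow> adjointable T"
  unfolding adjointable_def using is_adjoint_clinear by blast

lemma is_adjoint_id: "is_adjoint id id"
  by (simp add: is_adjoint_def)

lemma is_adjoint_zero: "is_adjoint (\<lambda>_. 0) (\<lambda>_. 0)"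
  by (simp add: is_adjoint_def cinner_zero_left cinner_zero_right)

lemma is_adjoint_comp: "is_adjoint T S \<Longrightarrow> is_adjoint T' S' \<Longrightarrow> is_adjoint (T \<circ> T') (S' \<circ> S)"
  by (simp add: is_adjoint_def)

lemma is_adjoint_add:
  "is_adjoint T S \<Longrightarrow> is_adjoint T' S' \<Longrightarrow> is_adjoint (\<lambda>x. T x + T' x) (\<lambda>x. S x + S' x)"
  by (simp add: is_adjoint_def cinner_add_left cinner_add_right)

lemma is_adjoint_scaleC:
  "is_adjoint T S \<Longrightarrow> is_adjoint (\<lambda>x. c *\<^sub>C T x) (\<lambda>x. cnj c *\<^sub>C S x)"
  by (simp add: is_adjoint_def cinner_scaleC_left cinner_scaleC_right)

section \<open>Triangular block operators on \<open>\<complex> \<oplus> H \<oplus> \<complex>\<close>\<close>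

text \<open>The tuple \<open>(e, T, S, x, y, l)\<close> stands for the block matrix with rows \<open>(e, \<langle>x, \<cdot>\<rangle>, l)\<close>,
  \<open>(0, T, y)\<close> and \<open>(0, 0, e)\<close>, where \<open>S\<close> is the adjoint of \<open>T\<close>. The involution reflects the matrix
  in its antidiagonal and takes adjoints of the entries.\<close>

typedef (overloaded) 'h triangular =
  "{(e :: complex, T :: 'h::complex_inner \<Rightarrow> 'h, S :: 'h \<Rightarrow> 'h, x :: 'h, y :: 'h, l :: complex).
      is_adjoint T S}"
  using is_adjoint_id by blast

setup_lifting type_definition_triangular

lift_definition tr_diag :: "'h::complex_inner triangular \<Rightarrow> complex" is "\<lambda>(e, T, S, x, y, l). e" .
lift_definition tr_op :: "'h::complex_inner triangular \<Rightarrow> 'h \<Rightarrow> 'h" is "\<lambda>(e, T, S, x, y, l). T" .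
lift_definition tr_adj :: "'h::complex_inner triangular \<Rightarrow> 'h \<Rightarrow> 'h" is "\<lambda>(e, T, S, x, y, l). S" .
lift_definition tr_row :: "'h::complex_inner triangular \<Rightarrow> 'h" is "\<lambda>(e, T, S, x, y, l). x" .
lift_definition tr_col :: "'h::complex_inner triangular \<Rightarrow> 'h" is "\<lambda>(e, T, S, x, y, l). y" .
lift_definition tr_corner :: "'h::complex_inner triangular \<Rightarrow> complex"
  is "\<lambda>(e, T, S, x, y, l). l" .

lemma triangular_eqI:
  assumes "tr_diag a = tr_diag b" "\<And>z. tr_op a z = tr_op b z" "\<And>z. tr_adj a z = tr_adj b z"
    "tr_row a = tr_row b" "tr_col a = tr_col b" "tr_corner a = tr_corner b"
  shows "a = b"
proof -
  have "tr_op a = tr_op b" "tr_adj a = tr_adj b" using assms(2,3) by blast+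
  with assms(1,4-6) show ?thesis by transfer auto
qed

lemma is_adjoint_tr: "is_adjoint (tr_op a) (tr_adj a)"
  by transfer auto

lemma triangular_exists:
  assumes "is_adjoint T S"
  shows "\<exists>t. tr_diag t = e \<and> tr_op t = T \<and> tr_adj t = S \<and> tr_row t = x \<and> tr_col t = y
    \<and> tr_corner t = l"
  by (rule exI[of _ "Abs_triangular (e, T, S, x, y, l)"])
     (simp add: assms tr_diag.rep_eq tr_op.rep_eq tr_adj.rep_eq tr_row.rep_eq tr_col.rep_eq
       tr_corner.rep_eq Abs_triangular_inverse)

instantiation triangular :: (complex_inner) complex_star_algebra
begin

lift_definition zero_triangular :: "'a triangular" is "(0, \<lambda>_. 0, \<lambda>_. 0, 0, 0, 0)"
  by (simp add: is_adjoint_zero)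
lift_definition one_triangular :: "'a triangular" is "(1, id, id, 0, 0, 0)"
  by (simp add: is_adjoint_id)
lift_definition plus_triangular :: "'a triangular \<Rightarrow> 'a triangular \<Rightarrow> 'a triangular" is
  "\<lambda>(e, T, S, x, y, l) (e', T', S', x', y', l').
     (e + e', \<lambda>z. T z + T' z, \<lambda>z. S z + S' z, x + x', y + y', l + l')"
  by (auto simp: is_adjoint_add)
lift_definition scaleC_triangular :: "complex \<Rightarrow> 'a triangular \<Rightarrow> 'a triangular" is
  "\<lambda>c (e, T, S, x, y, l).
     (c * e, \<lambda>z. c *\<^sub>C T z, \<lambda>z. cnj c *\<^sub>C S z, cnj c *\<^sub>C x, c *\<^sub>C y, c * l)"
  by (auto simp: is_adjoint_scaleC)
lift_definition times_triangular :: "'a triangular \<Rightarrow> 'a triangular \<Rightarrow> 'a triangular" is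
  "\<lambda>(e, T, S, x, y, l) (e', T', S', x', y', l').
     (e * e', T \<circ> T', S' \<circ> S, S' x + cnj e *\<^sub>C x', T y' + e' *\<^sub>C y,
      e * l' + cinner x y' + l * e')"
  by (auto simp: is_adjoint_comp)
lift_definition star_triangular :: "'a triangular \<Rightarrow> 'a triangular" is
  "\<lambda>(e, T, S, x, y, l). (cnj e, S, T, y, x, cnj l)"
  by (auto simp: is_adjoint_sym)
definition uminus_triangular :: "'a triangular \<Rightarrow> 'a triangular" where
  "uminus_triangular a = (-1) *\<^sub>C a"
definition minus_triangular :: "'a triangular \<Rightarrow> 'a triangular \<Rightarrow> 'a triangular" where
  "minus_triangular a b = a + - b"

lemma tr_diag_simps:
  "tr_diag (0 :: 'a triangular) = 0" "tr_diag (1 :: 'a triangular) = 1"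
  "tr_diag (a + b) = tr_diag a + tr_diag (b :: 'a triangular)"
  "tr_diag (c *\<^sub>C a) = c * tr_diag a"
  "tr_diag (a * b) = tr_diag a * tr_diag b"
  "tr_diag (a\<^sup>\<star>) = cnj (tr_diag a)"
  by (transfer; auto)+

lemma tr_op_simps:
  "tr_op (0 :: 'a triangular) z = 0" "tr_op (1 :: 'a triangular) z = z"
  "tr_op (a + b) z = tr_op a z + tr_op (b :: 'a triangular) z"
  "tr_op (c *\<^sub>C a) z = c *\<^sub>C tr_op a z"
  "tr_op (a * b) z = tr_op a (tr_op b z)"
  "tr_op (a\<^sup>\<star>) z = tr_adj a z"
  by (transfer; auto)+

lemma tr_adj_simps:
  "tr_adj (0 :: 'a triangular) z = 0" "tr_adj (1 :: 'a triangular) z = z"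
  "tr_adj (a + b) z = tr_adj a z + tr_adj (b :: 'a triangular) z"
  "tr_adj (c *\<^sub>C a) z = cnj c *\<^sub>C tr_adj a z"
  "tr_adj (a * b) z = tr_adj b (tr_adj a z)"
  "tr_adj (a\<^sup>\<star>) z = tr_op a z"
  by (transfer; auto)+

lemma tr_row_simps:
  "tr_row (0 :: 'a triangular) = 0" "tr_row (1 :: 'a triangular) = 0"
  "tr_row (a + b) = tr_row a + tr_row (b :: 'a triangular)"
  "tr_row (c *\<^sub>C a) = cnj c *\<^sub>C tr_row a"
  "tr_row (a * b) = tr_adj b (tr_row a) + cnj (tr_diag a) *\<^sub>C tr_row b"
  "tr_row (a\<^sup>\<star>) = tr_col a"
  by (transfer; auto)+

lemma tr_col_simps:
  "tr_col (0 :: 'a triangular) = 0" "tr_col (1 :: 'a triangular) = 0"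
  "tr_col (a + b) = tr_col a + tr_col (b :: 'a triangular)"
  "tr_col (c *\<^sub>C a) = c *\<^sub>C tr_col a"
  "tr_col (a * b) = tr_op a (tr_col b) + tr_diag b *\<^sub>C tr_col a"
  "tr_col (a\<^sup>\<star>) = tr_row a"
  by (transfer; auto)+

lemma tr_corner_simps:
  "tr_corner (0 :: 'a triangular) = 0" "tr_corner (1 :: 'a triangular) = 0"
  "tr_corner (a + b) = tr_corner a + tr_corner (b :: 'a triangular)"
  "tr_corner (c *\<^sub>C a) = c * tr_corner a"
  "tr_corner (a * b) = tr_diag a * tr_corner b + cinner (tr_row a) (tr_col b)
     + tr_corner a * tr_diag b"
  "tr_corner (a\<^sup>\<star>) = cnj (tr_corner a)"
  by (transfer; auto)+

lemmas tr_simps =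
  tr_diag_simps tr_op_simps tr_adj_simps tr_row_simps tr_col_simps tr_corner_simps

lemma tr_op_linear:
  "tr_op a (z + w) = tr_op a z + tr_op a w" "tr_op a (c *\<^sub>C z) = c *\<^sub>C tr_op a z"
  using is_adjoint_clinear[OF is_adjoint_tr[of a]] by (simp_all add: clinear_def)

lemma tr_adj_linear:
  "tr_adj a (z + w) = tr_adj a z + tr_adj a w" "tr_adj a (c *\<^sub>C z) = c *\<^sub>C tr_adj a z"
  using is_adjoint_clinear[OF is_adjoint_sym[OF is_adjoint_tr[of a]]] by (simp_all add: clinear_def)

lemma cinner_tr_adj: "cinner (tr_adj a z) w = cinner z (tr_op a w)"
  using is_adjoint_tr[of a] by (simp add: is_adjoint_def)

instance
proof
  fix a b c :: "'a triangular" and s t :: complex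
  note rules = tr_simps tr_op_linear tr_adj_linear cinner_tr_adj cinner_add_left cinner_add_right
    cinner_scaleC_left cinner_scaleC_right scaleC_add_left scaleC_add_right scaleC_scaleC scaleC_one
    algebra_simps
  show "a + b + c = a + (b + c)" by (rule triangular_eqI) (simp_all add: rules)
  show "a + b = b + a" by (rule triangular_eqI) (simp_all add: rules)
  show "0 + a = a" by (rule triangular_eqI) (simp_all add: rules)
  show "- a + a = 0" unfolding uminus_triangular_def
    by (rule triangular_eqI) (simp_all add: tr_simps scaleC_minus_one)
  show "a - b = a + - b" by (rule minus_triangular_def)
  show "s *\<^sub>C (a + b) = s *\<^sub>C a + s *\<^sub>C b" by (rule triangular_eqI) (simp_all add: rules)
  show "(s + t) *\<^sub>C a = s *\<^sub>C a + t *\<^sub>C a" by (rule triangular_eqI) (simp_all add: rules)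
  show "s *\<^sub>C t *\<^sub>C a = (s * t) *\<^sub>C a" by (rule triangular_eqI) (simp_all add: rules)
  show "1 *\<^sub>C a = a" by (rule triangular_eqI) (simp_all add: rules)
  show "a * b * c = a * (b * c)" by (rule triangular_eqI) (simp_all add: rules)
  show "1 * a = a" by (rule triangular_eqI)
      (simp_all add: rules cinner_zero_left scaleC_zero_right clinear_zero
        is_adjoint_clinear[OF is_adjoint_sym[OF is_adjoint_tr[of a]]])
  show "a * 1 = a" by (rule triangular_eqI)
      (simp_all add: rules cinner_zero_right scaleC_zero_right clinear_zero
        is_adjoint_clinear[OF is_adjoint_tr[of a]])
  show "(a + b) * c = a * c + b * c" by (rule triangular_eqI) (simp_all add: rules)
  show "a * (b + c) = a * b + a * c" by (rule triangular_eqI) (simp_all add: rules)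
  show "(s *\<^sub>C a) * b = s *\<^sub>C (a * b)" by (rule triangular_eqI) (simp_all add: rules)
  show "a * (s *\<^sub>C b) = s *\<^sub>C (a * b)" by (rule triangular_eqI) (simp_all add: rules)
  show "(a + b)\<^sup>\<star> = a\<^sup>\<star> + b\<^sup>\<star>" by (rule triangular_eqI) (simp_all add: rules)
  show "(s *\<^sub>C a)\<^sup>\<star> = cnj s *\<^sub>C a\<^sup>\<star>" by (rule triangular_eqI) (simp_all add: rules)
  show "(a * b)\<^sup>\<star> = b\<^sup>\<star> * a\<^sup>\<star>"
    by (rule triangular_eqI) (simp_all add: rules flip: cinner_commute)
  show "(a\<^sup>\<star>)\<^sup>\<star> = a" by (rule triangular_eqI) (simp_all add: rules)
qed

end

section \<open>Schuermann triples as homomorphisms into triangular block operators\<close>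

lemma star_homD:
  assumes "star_hom f"
  shows "clinear f" "f (a + b) = f a + f b" "f (c *\<^sub>C a) = c *\<^sub>C f a" "f 1 = 1" "f (a * b) = f a * f b"
    "f (a\<^sup>\<star>) = (f a)\<^sup>\<star>"
  using assms by (simp_all add: star_hom_def clinear_def)

lemma counit_unique:
  assumes "star_hom f" "\<And>k l. f (ugen k l) = (if k = l then 1 else 0)"
  shows "f = (counit :: 'd::finite U_alg \<Rightarrow> complex)"
proof -
  have "unitary_matrix (\<lambda>k l :: 'd. if k = l then 1 else 0 :: complex)"
    by (auto simp: unitary_matrix_def star_complex_def if_distrib[of "\<lambda>x. x * _"]
        if_distrib[of cnj] cong: if_cong)
  from U_alg_universal[OF this] show ?thesis
    using assms counit by blast
qed

lemma schuermann_tripleD: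
  assumes "schuermann_triple \<rho> \<eta> L"
  shows "adjointable (\<rho> a)" "\<rho> (a + b) = (\<lambda>x. \<rho> a x + \<rho> b x)" "\<rho> (c *\<^sub>C a) = (\<lambda>x. c *\<^sub>C \<rho> a x)"
    "\<rho> 1 = id" "\<rho> (a * b) = \<rho> a \<circ> \<rho> b" "is_adjoint (\<rho> a) (\<rho> (a\<^sup>\<star>))"
    "clinear \<eta>" "\<eta> (a + b) = \<eta> a + \<eta> b" "\<eta> (c *\<^sub>C a) = c *\<^sub>C \<eta> a"
    "\<eta> (a * b) = \<rho> a (\<eta> b) + counit b *\<^sub>C \<eta> a"
    "clinear L" "L (a + b) = L a + L b" "L (c *\<^sub>C a) = c * L a" "L (a\<^sup>\<star>) = cnj (L a)"
    "L (a * b) = counit a * L b + cinner (\<eta> (a\<^sup>\<star>)) (\<eta> b) + L a * counit b"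
proof -
  show "L (a * b) = counit a * L b + cinner (\<eta> (a\<^sup>\<star>)) (\<eta> b) + L a * counit b"
    using assms unfolding schuermann_triple_def
    by (metis (no_types, lifting) add.assoc add.commute add_diff_cancel_left' diff_add_eq
        diff_minus_eq_add minus_diff_eq)
qed (use assms is_adjoint_adj in
    \<open>auto simp: schuermann_triple_def star_representation_def clinear_def scaleC_complex_def\<close>)

lemma star_hom_imp_schuermann_triple:
  fixes f :: "'d::finite U_alg \<Rightarrow> 'h::complex_inner triangular"
  assumes f: "star_hom f" and diag: "\<And>k l. tr_diag (f (ugen k l)) = (if k = l then 1 else 0)"
  shows "schuermann_triple (\<lambda>a. tr_op (f a)) (\<lambda>a. tr_col (f a)) (\<lambda>a. tr_corner (f a))"
proof -
  note f_simps = star_homD(2-)[OF f] tr_simps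
  have "star_hom (\<lambda>a. tr_diag (f a))"
    by (simp add: star_hom_def clinear_def f_simps scaleC_complex_def star_complex_def)
  then have counit: "tr_diag (f a) = counit a" for a
    using counit_unique[of "\<lambda>a. tr_diag (f a)"] diag by metis
  have adj: "adj (tr_op (f a)) = tr_op (f (a\<^sup>\<star>))" for a
    by (rule adj_eqI) (use is_adjoint_tr[of "f a"] in \<open>simp add: is_adjoint_def f_simps\<close>)
  have "star_representation (\<lambda>a. tr_op (f a))"
    unfolding star_representation_def
    by (auto simp: adj f_simps is_adjoint_adjointable[OF is_adjoint_tr])
  then show ?thesis
    unfolding schuermann_triple_def
    by (auto simp: clinear_def f_simps counit scaleC_complex_def)
qed

lemma schuermann_triple_imp_star_hom:
  fixes \<rho> :: "'d::finite U_alg \<Rightarrow> 'h::complex_inner \<Rightarrow> 'h"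
  assumes triple: "schuermann_triple \<rho> \<eta> L"
  obtains f :: "'d U_alg \<Rightarrow> 'h triangular" where "star_hom f"
    "\<And>a. tr_diag (f a) = counit a" "\<And>a. tr_op (f a) = \<rho> a" "\<And>a. tr_adj (f a) = \<rho> (a\<^sup>\<star>)"
    "\<And>a. tr_row (f a) = \<eta> (a\<^sup>\<star>)" "\<And>a. tr_col (f a) = \<eta> a" "\<And>a. tr_corner (f a) = L a"
proof -
  note D = schuermann_tripleD[OF triple]
  note c = star_homD[OF counit(1)]
  have "\<exists>f. \<forall>a. tr_diag (f a) = counit a \<and> tr_op (f a) = \<rho> a \<and> tr_adj (f a) = \<rho> (a\<^sup>\<star>)
      \<and> tr_row (f a) = \<eta> (a\<^sup>\<star>) \<and> tr_col (f a) = \<eta> a \<and> tr_corner (f a) = L a"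
    by (rule choice, rule allI, rule triangular_exists, rule D(6))
  then obtain f :: "'d U_alg \<Rightarrow> 'h triangular"
    where f: "\<And>a. tr_diag (f a) = counit a" "\<And>a. tr_op (f a) = \<rho> a"
    "\<And>a. tr_adj (f a) = \<rho> (a\<^sup>\<star>)" "\<And>a. tr_row (f a) = \<eta> (a\<^sup>\<star>)" "\<And>a. tr_col (f a) = \<eta> a"
    "\<And>a. tr_corner (f a) = L a"
    by metis
  have \<eta>1: "\<eta> 1 = 0" using D(10)[of 1 1] by (simp add: D(4) c scaleC_one)
  have L1: "L 1 = 0" using D(15)[of 1 1] by (simp add: c \<eta>1 cinner_zero_right)
  have "star_hom f"
    unfolding star_hom_def clinear_def
    by (intro conjI allI; rule triangular_eqI)
       (simp_all add: f tr_simps D(2-5,8-10,12-15) c(2-) \<eta>1 L1 star_add star_mult star_scaleC star_star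
          star_one scaleC_complex_def star_complex_def)
  with f that show ?thesis by blast
qed

section \<open>Schuermann triples with prescribed parameters\<close>

lemma tr_sum:
  fixes f :: "'i \<Rightarrow> 'h::complex_inner triangular"
  shows "tr_diag (sum f I) = (\<Sum>i\<in>I. tr_diag (f i))"
    "tr_op (sum f I) z = (\<Sum>i\<in>I. tr_op (f i) z)"
    "tr_adj (sum f I) z = (\<Sum>i\<in>I. tr_adj (f i) z)"
    "tr_row (sum f I) = (\<Sum>i\<in>I. tr_row (f i))"
    "tr_col (sum f I) = (\<Sum>i\<in>I. tr_col (f i))"
    "tr_corner (sum f I) = (\<Sum>i\<in>I. tr_corner (f i))"
  by (induction I rule: infinite_finite_induct; simp add: tr_simps)+

lemma sum_delta_scaleC:
  fixes f :: "'d::finite \<Rightarrow> 'h::complex_inner"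
  shows "(\<Sum>j\<in>UNIV. (if j = k then 1 else 0) *\<^sub>C f j) = f k"
    "(\<Sum>j\<in>UNIV. (if k = j then 1 else 0) *\<^sub>C f j) = f k"
  by (simp_all add: if_distrib[of "\<lambda>c. c *\<^sub>C _"] scaleC_one scaleC_zero_left cong: if_cong)

text \<open>The entries of the isometry relation \<open>\<Sum>\<^sub>j v\<^sub>j\<^sub>k\<^sup>* v\<^sub>j\<^sub>l = \<delta>\<^sub>k\<^sub>l\<close> in the first row.\<close>

lemma unitary_triangular_row_corner:
  fixes v :: "'d::finite \<Rightarrow> 'd \<Rightarrow> 'h::complex_inner triangular"
  assumes v: "unitary_matrix v" and diag: "\<And>k l. tr_diag (v k l) = (if k = l then 1 else 0)"
  shows "tr_row (v k l) = - (\<Sum>j\<in>UNIV. tr_adj (v j l) (tr_col (v j k)))"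
    and "tr_corner (v k l) + cnj (tr_corner (v l k))
      = - (\<Sum>j\<in>UNIV. cinner (tr_col (v j k)) (tr_col (v j l)))"
proof -
  have rel: "(\<Sum>j\<in>UNIV. (v j k)\<^sup>\<star> * v j l) = (if k = l then 1 else 0)"
    using v by (simp add: unitary_matrix_def)
  have "(\<Sum>j\<in>UNIV. tr_adj (v j l) (tr_col (v j k))) + tr_row (v k l) = 0"
    using arg_cong[OF rel, of tr_row]
    by (simp add: tr_sum tr_simps diag sum.distrib sum_delta_scaleC split: if_splits)
  then show "tr_row (v k l) = - (\<Sum>j\<in>UNIV. tr_adj (v j l) (tr_col (v j k)))"
    by (metis add.commute eq_neg_iff_add_eq_0)
  have "tr_corner (v k l) + (\<Sum>j\<in>UNIV. cinner (tr_col (v j k)) (tr_col (v j l)))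
      + cnj (tr_corner (v l k)) = 0"
    using arg_cong[OF rel, of tr_corner]
    by (simp add: tr_sum tr_simps diag sum.distrib if_distrib[of cnj]
        if_distrib[of "\<lambda>x. x * _"] if_distrib[of "\<lambda>x. _ * x"] cong: if_cong split: if_splits)
  then show "tr_corner (v k l) + cnj (tr_corner (v l k))
      = - (\<Sum>j\<in>UNIV. cinner (tr_col (v j k)) (tr_col (v j l)))"
    by (simp add: eq_neg_iff_add_eq_0 algebra_simps)
qed

definition generator_block ::
    "('h::complex_inner ^ 'd::finite \<Rightarrow> 'h ^ 'd) \<Rightarrow> 'h ^ 'd ^ 'd \<Rightarrow> complex ^ 'd ^ 'd
      \<Rightarrow> 'd \<Rightarrow> 'd \<Rightarrow> 'h triangular" where
  "generator_block U A \<Lambda> j k = Abs_triangular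
     (if j = k then 1 else 0, proj j \<circ> U \<circ> axis k, proj k \<circ> adj U \<circ> axis j,
      - (adj U (column j A) $ k), A $ j $ k,
      \<i> * \<Lambda> $ j $ k - cinner (column j A) (column k A) / 2)"

lemma is_adjoint_proj_axis:
  fixes U :: "'h::complex_inner ^ 'd::finite \<Rightarrow> 'h ^ 'd"
  assumes "is_adjoint U V"
  shows "is_adjoint (proj j \<circ> U \<circ> axis k) (proj k \<circ> V \<circ> axis j)"
  using is_adjoint_comp[OF is_adjoint_comp[OF is_adjoint_proj assms]
      is_adjoint_sym[OF is_adjoint_proj]]
  by (simp add: comp_assoc)

lemma generator_block_sel:
  fixes U :: "'h::complex_inner ^ 'd::finite \<Rightarrow> 'h ^ 'd"
  assumes "adjointable U"
  shows "tr_diag (generator_block U A \<Lambda> j k) = (if j = k then 1 else 0)"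
    "tr_op (generator_block U A \<Lambda> j k) = proj j \<circ> U \<circ> axis k"
    "tr_adj (generator_block U A \<Lambda> j k) = proj k \<circ> adj U \<circ> axis j"
    "tr_row (generator_block U A \<Lambda> j k) = - (adj U (column j A) $ k)"
    "tr_col (generator_block U A \<Lambda> j k) = A $ j $ k"
    "tr_corner (generator_block U A \<Lambda> j k)
      = \<i> * \<Lambda> $ j $ k - cinner (column j A) (column k A) / 2"
  by (simp_all add: generator_block_def Abs_triangular_inverse
      is_adjoint_proj_axis[OF is_adjoint_adj[OF assms]] tr_diag.rep_eq tr_op.rep_eq tr_adj.rep_eq
      tr_row.rep_eq tr_col.rep_eq tr_corner.rep_eq)

lemma sum_axis: "(\<Sum>j\<in>UNIV. axis j (x $ j)) = (x :: 'h::complex_inner ^ 'd::finite)"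
  by (simp add: vec_eq_iff axis_def)

lemma sum_clinear_axis:
  fixes U :: "'h::complex_inner ^ 'd::finite \<Rightarrow> 'h ^ 'd"
  assumes "clinear U"
  shows "(\<Sum>j\<in>UNIV. U (axis j (x $ j)) $ k) = U x $ k"
  using clinear_sum[OF assms, of "\<lambda>j. axis j (x $ j)" UNIV] by (simp add: sum_axis)

lemma axis_nth: "axis l z $ k = (if k = l then z else 0)"
  by (simp add: axis_def)

lemma cinner_column: "cinner (column k A) (column l A) = (\<Sum>j\<in>UNIV. cinner (A $ j $ k) (A $ j $ l))"
  by (simp add: cinner_vec_def column_def)

lemma unitary_matrix_generator_block:
  fixes U :: "'h::complex_inner ^ 'd::finite \<Rightarrow> 'h ^ 'd"
  assumes U: "unitary U" and herm: "hermitian \<Lambda>"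
  shows "unitary_matrix (generator_block U A \<Lambda>)"
proof -
  define V where "V = adj U"
  have adjointable: "adjointable U" using U by (simp add: unitary_def)
  then have adj: "is_adjoint U V" unfolding V_def by (rule is_adjoint_adj)
  note sel = generator_block_sel[OF adjointable, of A \<Lambda>, folded V_def]
  have UV: "U (V x) = x" and VU: "V (U x) = x" for x
    using U by (auto simp: unitary_def V_def fun_eq_iff)
  have lin: "clinear U" "clinear V"
    using adj is_adjoint_sym is_adjoint_clinear by blast+
  have V_sum: "(\<Sum>j\<in>UNIV. V (axis j (A $ j $ k)) $ l) = V (column k A) $ l" for k l
    using sum_clinear_axis[OF lin(2), of "column k A" l] by (simp add: column_def)
  have col: "column k A $ l = A $ l $ k" for k l by (simp add: column_def)
  have cinner_V: "(\<Sum>j\<in>UNIV. cinner (V x $ j) (V y $ j)) = cinner x y" for x y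
    using adj by (simp add: is_adjoint_def UV flip: cinner_vec_def)
  have axis_minus: "axis j (- x) = - axis j x" for j :: 'd and x :: 'h
    by (simp add: vec_eq_iff axis_def)
  have herm': "cnj (\<Lambda> $ j $ k) = \<Lambda> $ k $ j" for j k
    using herm unfolding hermitian_def by metis
  note rules = tr_sum tr_simps sel proj_def sum.distrib sum_delta_scaleC sum_clinear_axis lin
    UV VU V_sum col cinner_V axis_minus clinear_minus sum_negf sum_subtractf axis_nth if_distrib[of cnj]
    if_distrib[of "\<lambda>x. x * _"] if_distrib[of "\<lambda>x. _ * x"] herm' cnj_cinner
    cinner_minus_left cinner_minus_right cinner_column[symmetric]
  have "(\<Sum>j\<in>UNIV. generator_block U A \<Lambda> k j * (generator_block U A \<Lambda> l j)\<^sup>\<star>)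
      = (if k = l then 1 else 0)" for k l
    by (rule triangular_eqI) (simp_all add: rules cong: if_cong)
  moreover have "(\<Sum>j\<in>UNIV. (generator_block U A \<Lambda> j k)\<^sup>\<star> * generator_block U A \<Lambda> j l)
      = (if k = l then 1 else 0)" for k l
    by (rule triangular_eqI) (simp_all add: rules cong: if_cong)
  ultimately show ?thesis by (simp add: unitary_matrix_def)
qed

lemma unitary_matrix_star_hom:
  assumes f: "star_hom f" and v: "unitary_matrix v"
  shows "unitary_matrix (\<lambda>j k. f (v j k))"
proof -
  have "(\<Sum>j\<in>UNIV. f (v k j) * (f (v l j))\<^sup>\<star>) = f (\<Sum>j\<in>UNIV. v k j * (v l j)\<^sup>\<star>)"
    "(\<Sum>j\<in>UNIV. (f (v j k))\<^sup>\<star> * f (v j l)) = f (\<Sum>j\<in>UNIV. (v j k)\<^sup>\<star> * v j l)" for k l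
    by (simp_all add: clinear_sum[OF star_homD(1)[OF f]] star_homD[OF f])
  then show ?thesis
    using v by (simp add: unitary_matrix_def star_homD(4)[OF f] clinear_zero[OF star_homD(1)[OF f]])
qed

lemma schuermann_triple_generator_block:
  fixes U :: "'h::complex_inner ^ 'd::finite \<Rightarrow> 'h ^ 'd"
  assumes U: "unitary U" and triple: "schuermann_triple \<rho> \<eta> L"
    and params: "has_parameters \<rho> \<eta> L U A \<Lambda>"
  obtains f where "star_hom f" "\<And>j k. f (ugen j k) = generator_block U A \<Lambda> j k"
    "\<And>a. tr_op (f a) = \<rho> a" "\<And>a. tr_col (f a) = \<eta> a" "\<And>a. tr_corner (f a) = L a"
proof -
  obtain f where f: "star_hom f"
    "\<And>a. tr_diag (f a) = counit a" "\<And>a. tr_op (f a) = \<rho> a" "\<And>a. tr_adj (f a) = \<rho> (a\<^sup>\<star>)"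
    "\<And>a. tr_row (f a) = \<eta> (a\<^sup>\<star>)" "\<And>a. tr_col (f a) = \<eta> a" "\<And>a. tr_corner (f a) = L a"
    using schuermann_triple_imp_star_hom[OF triple] by blast
  note D = schuermann_tripleD[OF triple]
  have adjointable: "adjointable U" using U by (simp add: unitary_def)
  have adj: "is_adjoint U (adj U)" by (rule is_adjoint_adj[OF adjointable])
  have lin: "clinear (adj U)" using adj is_adjoint_sym is_adjoint_clinear by blast
  have \<rho>: "\<rho> (ugen j k) = proj j \<circ> U \<circ> axis k" and \<eta>: "\<eta> (ugen j k) = A $ j $ k"
    and L: "L (ugen j k) - cnj (L (ugen k j)) = 2 * \<i> * \<Lambda> $ j $ k" for j k
    using params clinear_diff[OF D(11)] by (auto simp: has_parameters_def adj_proj D(14))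
  have \<rho>_star: "\<rho> ((ugen j k)\<^sup>\<star>) = proj k \<circ> adj U \<circ> axis j" for j k
    using adj_eqI[OF D(6)[of "ugen j k"]] adj_eqI[OF is_adjoint_proj_axis[OF adj, of j k]]
    by (simp add: \<rho>)
  note rc = unitary_triangular_row_corner[OF unitary_matrix_star_hom[OF f(1) unitary_matrix_u]]
  have row: "tr_row (f (ugen j k)) = - (adj U (column j A) $ k)" for j k
    using rc(1)[of j k] sum_clinear_axis[OF lin, of "column j A" k]
    by (simp add: f counit(2) \<rho>_star \<eta> proj_def column_def)
  have corner: "L (ugen j k) = \<i> * \<Lambda> $ j $ k - cinner (column j A) (column k A) / 2" for j k
  proof -
    have "L (ugen j k) + cnj (L (ugen k j)) = - cinner (column j A) (column k A)"
      using rc(2)[of j k] by (simp add: f counit(2) \<eta> cinner_column)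
    with L[of j k] have "2 * L (ugen j k) = 2 * \<i> * \<Lambda> $ j $ k - cinner (column j A) (column k A)"
      by (simp add: algebra_simps)
    then show ?thesis by (simp add: field_simps)
  qed
  have "f (ugen j k) = generator_block U A \<Lambda> j k" for j k
    by (rule triangular_eqI)
       (simp_all only: generator_block_sel[OF adjointable] row f(2-4,6,7) counit(2) \<rho> \<rho>_star \<eta> corner)
  with f that show ?thesis by blast
qed

lemma schuermann_triple_ex1:
  fixes U :: "'h::complex_inner ^ 'd::finite \<Rightarrow> 'h ^ 'd"
  assumes U: "unitary U" and herm: "hermitian \<Lambda>"
  shows "\<exists>!t. case t of (\<rho>, \<eta>, L) \<Rightarrow> schuermann_triple \<rho> \<eta> L \<and> has_parameters \<rho> \<eta> L U A \<Lambda>"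
proof -
  have adjointable: "adjointable U" using U by (simp add: unitary_def)
  obtain f where f: "star_hom f" "\<And>j k. f (ugen j k) = generator_block U A \<Lambda> j k"
    and f_unique: "\<And>g. star_hom g \<Longrightarrow> (\<And>j k. g (ugen j k) = generator_block U A \<Lambda> j k) \<Longrightarrow> g = f"
    using U_alg_universal[OF unitary_matrix_generator_block[OF U herm, of A]] by blast
  let ?\<rho> = "\<lambda>a. tr_op (f a)" and ?\<eta> = "\<lambda>a. tr_col (f a)" and ?L = "\<lambda>a. tr_corner (f a)"
  note sel = generator_block_sel[OF adjointable]
  have triple: "schuermann_triple ?\<rho> ?\<eta> ?L"
    by (rule star_hom_imp_schuermann_triple[OF f(1)]) (simp add: f(2) sel)
  have herm': "cnj (\<Lambda> $ j $ k) = \<Lambda> $ k $ j" for j k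
    using herm unfolding hermitian_def by metis
  have "?L (ugen j k - (ugen k j)\<^sup>\<star>) = 2 * \<i> * \<Lambda> $ j $ k" for j k
  proof -
    have "?L (ugen j k - (ugen k j)\<^sup>\<star>) = ?L (ugen j k) - cnj (?L (ugen k j))"
      using schuermann_tripleD(14)[OF triple] clinear_diff[OF schuermann_tripleD(11)[OF triple]] by simp
    also have "\<dots> = 2 * \<i> * \<Lambda> $ j $ k"
      by (simp add: f(2) sel herm' cnj_cinner)
    finally show ?thesis .
  qed
  then have params: "has_parameters ?\<rho> ?\<eta> ?L U A \<Lambda>"
    by (simp add: has_parameters_def f(2) sel adj_proj)
  show ?thesis
  proof (rule ex1I[of _ "(?\<rho>, ?\<eta>, ?L)"])
    fix t assume "case t of (\<rho>, \<eta>, L) \<Rightarrow> schuermann_triple \<rho> \<eta> L \<and> has_parameters \<rho> \<eta> L U A \<Lambda>"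
    then obtain \<rho> \<eta> L where t: "t = (\<rho>, \<eta>, L)" "schuermann_triple \<rho> \<eta> L" "has_parameters \<rho> \<eta> L U A \<Lambda>"
      by (cases t) auto
    obtain g where "star_hom g" "\<And>j k. g (ugen j k) = generator_block U A \<Lambda> j k"
      and g: "\<And>a. tr_op (g a) = \<rho> a" "\<And>a. tr_col (g a) = \<eta> a" "\<And>a. tr_corner (g a) = L a"
      using schuermann_triple_generator_block[OF U t(2,3)] by blast
    then have "g = f" using f_unique by blast
    with g t(1) show "t = (?\<rho>, ?\<eta>, ?L)" by auto
  qed (use triple params in simp)
qed

section \<open>The unitary operator of a Schuermann triple\<close>

lemma schuermann_triple_unitary:
  fixes \<rho> :: "'d::finite U_alg \<Rightarrow> 'h::complex_inner \<Rightarrow> 'h"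
  assumes triple: "schuermann_triple \<rho> \<eta> L"
  obtains U V where "is_adjoint U V" "V \<circ> U = id" "U \<circ> V = id"
    "\<And>j k x. \<rho> (ugen j k) x = U (axis k x) $ j"
    "\<And>j k x. \<rho> ((ugen j k)\<^sup>\<star>) x = V (axis j x) $ k"
proof -
  note D = schuermann_tripleD[OF triple]
  define U :: "'h ^ 'd \<Rightarrow> 'h ^ 'd" where "U x = (\<chi> j. \<Sum>k\<in>UNIV. \<rho> (ugen j k) (x $ k))" for x
  define V :: "'h ^ 'd \<Rightarrow> 'h ^ 'd" where "V x = (\<chi> k. \<Sum>j\<in>UNIV. \<rho> ((ugen j k)\<^sup>\<star>) (x $ j))" for x
  have lin: "clinear (\<rho> a)" for a
    using D(1) by (simp add: adjointable_def)
  have \<rho>0: "\<rho> 0 x = 0" for x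
    using D(3)[of 0 0] by (simp add: scaleC_zero_left fun_eq_iff)
  have \<rho>_sum: "\<rho> (sum g I) x = (\<Sum>i\<in>I. \<rho> (g i) x)" for g :: "'d \<Rightarrow> 'd U_alg" and I x
    by (induction I rule: infinite_finite_induct) (simp_all add: \<rho>0 D(2))
  have comp: "\<rho> a (\<rho> b x) = \<rho> (a * b) x" for a b x
    by (simp add: D(5))
  have adj: "cinner (\<rho> (a\<^sup>\<star>) y) x = cinner y (\<rho> a x)" for a x y
    using D(6)[of a] by (simp add: is_adjoint_def)
  have delta: "\<rho> (if j = k then 1 else 0) x = (if j = k then x else 0)" for j k :: 'd and x
    by (simp add: D(4) \<rho>0)
  have u_rel: "(\<Sum>j\<in>UNIV. ugen k j * (ugen l j)\<^sup>\<star>) = (if k = l then 1 else 0)"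
    "(\<Sum>j\<in>UNIV. (ugen j k)\<^sup>\<star> * ugen j l) = (if k = l then 1 else 0)" for k l :: 'd
    using unitary_matrix_u[where 'd = 'd] unfolding unitary_matrix_def by blast+
  have adjUV: "is_adjoint U V"
    unfolding is_adjoint_def cinner_vec_def U_def V_def
    by (auto simp: cinner_sum_left cinner_sum_right adj intro: sum.swap)
  have VU: "V (U x) = x" for x
  proof -
    have "V (U x) $ k = x $ k" for k
    proof -
      have "V (U x) $ k = (\<Sum>l\<in>UNIV. \<Sum>j\<in>UNIV. \<rho> ((ugen j k)\<^sup>\<star> * ugen j l) (x $ l))"
        unfolding U_def V_def
        by (simp add: clinear_sum[OF lin] comp) (rule sum.swap)
      also have "\<dots> = (\<Sum>l\<in>UNIV. if k = l then x $ l else 0)"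
        by (simp add: u_rel delta flip: \<rho>_sum)
      finally show ?thesis by simp
    qed
    then show ?thesis by (simp add: vec_eq_iff)
  qed
  have UV: "U (V x) = x" for x
  proof -
    have "U (V x) $ k = x $ k" for k
    proof -
      have "U (V x) $ k = (\<Sum>l\<in>UNIV. \<Sum>j\<in>UNIV. \<rho> (ugen k j * (ugen l j)\<^sup>\<star>) (x $ l))"
        unfolding U_def V_def
        by (simp add: clinear_sum[OF lin] comp) (rule sum.swap)
      also have "\<dots> = (\<Sum>l\<in>UNIV. if k = l then x $ l else 0)"
        by (simp add: u_rel delta flip: \<rho>_sum)
      finally show ?thesis by simp
    qed
    then show ?thesis by (simp add: vec_eq_iff)
  qed
  have axis: "\<rho> a (axis k x $ j) = (if j = k then \<rho> a x else 0)" for a x and j k :: 'd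
    by (simp add: axis_nth clinear_zero[OF lin])
  show ?thesis
    by (rule that[of U V]) (use adjUV VU UV in \<open>auto simp: fun_eq_iff U_def V_def axis\<close>)
qed

lemma schuermann_triple_parameters:
  fixes \<rho> :: "'d::finite U_alg \<Rightarrow> 'h::complex_inner \<Rightarrow> 'h"
  assumes triple: "schuermann_triple \<rho> \<eta> L"
  shows "\<exists>U A \<Lambda>. unitary U \<and> hermitian \<Lambda> \<and> has_parameters \<rho> \<eta> L U A \<Lambda>"
proof -
  note D = schuermann_tripleD[OF triple]
  obtain U V where UV: "is_adjoint U V" "V \<circ> U = id" "U \<circ> V = id"
    and \<rho>: "\<And>j k x. \<rho> (ugen j k) x = U (axis k x) $ j"
    by (rule schuermann_triple_unitary[OF triple]) (rule that; assumption)
  have "unitary U"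
    unfolding unitary_def adj_eqI[OF UV(1)] using UV is_adjoint_adjointable by blast
  moreover define \<Lambda> :: "complex ^ 'd ^ 'd"
    where "\<Lambda> = (\<chi> j k. L (ugen j k - (ugen k j)\<^sup>\<star>) / (2 * \<i>))"
  have "hermitian \<Lambda>"
    unfolding hermitian_def \<Lambda>_def
    by (simp add: clinear_diff[OF D(11)] D(14) field_simps)
  moreover have "has_parameters \<rho> \<eta> L U (\<chi> j k. \<eta> (ugen j k)) \<Lambda>"
    by (simp add: has_parameters_def \<Lambda>_def adj_proj fun_eq_iff \<rho> proj_def)
  ultimately show ?thesis by blast
qed

section \<open>Extension to the completion\<close>

lemma norm_scaleC: "norm (c *\<^sub>C x) = cmod c * norm (x :: 'a::complex_inner)"
proof -
  have "complex_of_real ((norm (c *\<^sub>C x))\<^sup>2) = complex_of_real ((cmod c * norm x)\<^sup>2)"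
    unfolding power_mult_distrib of_real_mult complex_norm_square cinner_self[symmetric]
    by (simp add: cinner_scaleC_left cinner_scaleC_right mult_ac)
  then show ?thesis
    unfolding of_real_eq_iff by (simp add: power2_eq_iff_nonneg)
qed

lemma bounded_linear_scaleC: "bounded_linear (\<lambda>x :: 'a::complex_inner. c *\<^sub>C x)"
  by (rule bounded_linear_intro[of _ "cmod c"])
     (simp_all add: scaleC_add_right norm_scaleC scaleR_scaleC scaleC_scaleC mult.commute)

lemma continuous_on_scaleC:
  "continuous_on S f \<Longrightarrow> continuous_on S (\<lambda>x. c *\<^sub>C (f x :: 'a::complex_inner))"
  by (rule bounded_linear.continuous_on[OF bounded_linear_scaleC])

lemma cinner_polarization:
  "cinner x y = (complex_of_real ((norm (x + y))\<^sup>2 - (norm (x + - y))\<^sup>2)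
     - \<i> * complex_of_real ((norm (x + \<i> *\<^sub>C y))\<^sup>2 - (norm (x + - (\<i> *\<^sub>C y)))\<^sup>2)) / 4"
  for x :: "'a::complex_inner"
  unfolding of_real_diff cinner_self[symmetric]
  by (simp only: cinner_add_left cinner_add_right cinner_scaleC_left cinner_scaleC_right
      cinner_minus_left cinner_minus_right) (simp add: algebra_simps)

lemma continuous_on_cinner:
  fixes f g :: "'b::topological_space \<Rightarrow> 'a::complex_inner"
  assumes "continuous_on S f" "continuous_on S g"
  shows "continuous_on S (\<lambda>x. cinner (f x) (g x))"
  unfolding cinner_polarization
  by (intro continuous_intros continuous_on_scaleC assms) simp_all

lemma norm_eq_cinnerI: "cinner x x = cinner y y \<Longrightarrow> norm x = norm y"
  for x :: "'a::complex_inner" and y :: "'b::complex_inner"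
  unfolding cinner_self of_real_eq_iff by (simp add: power2_eq_iff_nonneg)

lemma completion_norm: "is_completion \<iota> \<Longrightarrow> norm (\<iota> x) = norm x"
  by (rule norm_eq_cinnerI) (simp add: is_completion_def)

lemma completion_ext:
  fixes f g :: "'h::complex_hilbert \<Rightarrow> 'b::t2_space"
  assumes \<iota>: "is_completion \<iota>" and cont: "continuous_on UNIV f" "continuous_on UNIV g"
    and eq: "\<And>x. f (\<iota> x) = g (\<iota> x)"
  shows "f y = g y"
proof -
  have "closure (range \<iota>) \<subseteq> {y. f y = g y}"
    by (rule closure_minimal) (auto simp: eq intro: closed_Collect_eq cont)
  then show ?thesis
    using \<iota> by (auto simp: is_completion_def)
qed

lemma completion_extend_contraction:
  fixes \<iota> :: "'p::complex_inner \<Rightarrow> 'h::complex_hilbert" and T :: "'p \<Rightarrow> 'p"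
  assumes \<iota>: "is_completion \<iota>" and lin: "clinear T" and bound: "\<And>x. norm (T x) \<le> norm x"
  shows "\<exists>T'. continuous_on UNIV T' \<and> (\<forall>x. T' (\<iota> x) = \<iota> (T x))"
proof -
  have lin_\<iota>: "clinear \<iota>" using \<iota> by (simp add: is_completion_def)
  have norm_\<iota>: "norm (\<iota> x - \<iota> y) = norm (x - y)" for x y
    using completion_norm[OF \<iota>, of "x - y"] by (simp add: clinear_diff[OF lin_\<iota>])
  then have "inj \<iota>" by (metis injI norm_eq_zero right_minus_eq)
  then have inv: "inv \<iota> (\<iota> x) = x" for x by simp
  have "1-lipschitz_on (range \<iota>) (\<lambda>y. \<iota> (T (inv \<iota> y)))"
    using bound by (auto simp: lipschitz_on_def inv dist_norm norm_\<iota> simp flip: clinear_diff[OF lin])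
  from lipschitz_extend_closure[OF this] obtain T'
    where "1-lipschitz_on (closure (range \<iota>)) T'" "\<forall>x. T' (\<iota> x) = \<iota> (T x)"
    by (auto simp: inv)
  then show ?thesis
    using \<iota> lipschitz_on_continuous_on unfolding is_completion_def by metis
qed

lemma U_alg_induct [case_names ugen zero one add scaleC mult star]:
  assumes "\<And>j k. P (ugen j k)" "P 0" "P 1" "\<And>a b. P a \<Longrightarrow> P b \<Longrightarrow> P (a + b)"
    "\<And>c a. P a \<Longrightarrow> P (c *\<^sub>C a)" "\<And>a b. P a \<Longrightarrow> P b \<Longrightarrow> P (a * b)" "\<And>a. P a \<Longrightarrow> P (a\<^sup>\<star>)"
  shows "P a"
proof (induct a rule: U_alg.abs_induct)
  case (1 t)
  show ?case
    by (induction t) (use assms in \<open>simp_all add: ugen.abs_eq zero_U_alg.abs_eq one_U_alg.abs_eq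
        plus_U_alg.abs_eq[symmetric] scaleC_U_alg.abs_eq[symmetric] times_U_alg.abs_eq[symmetric]
        star_U_alg.abs_eq[symmetric] flip: ugen.abs_eq zero_U_alg.abs_eq one_U_alg.abs_eq\<close>)
qed

lemma norm_isometry:
  assumes "is_adjoint U V" "V \<circ> U = id"
  shows "norm (U x) = norm x"
  using assms unfolding is_adjoint_def by (metis comp_apply id_apply norm_eq_cinnerI)

lemma norm_axis: "norm (axis k x) = norm (x :: 'h::complex_inner)"
  by (rule norm_isometry[OF is_adjoint_sym[OF is_adjoint_proj]]) (simp add: fun_eq_iff proj_def)

lemma schuermann_triple_extends:
  fixes \<rho> :: "'d::finite U_alg \<Rightarrow> 'p::complex_inner \<Rightarrow> 'p" and \<iota> :: "'p \<Rightarrow> 'h::complex_hilbert"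
  assumes triple: "schuermann_triple \<rho> \<eta> L" and \<iota>: "is_completion \<iota>"
  shows "\<exists>\<rho>' \<eta>'. schuermann_triple \<rho>' \<eta>' L \<and> extends_along \<iota> \<rho> \<eta> \<rho>' \<eta>'"
proof -
  note D = schuermann_tripleD[OF triple]
  have lin: "clinear (\<rho> a)" for a
    using D(1) by (simp add: adjointable_def)
  have \<iota>_simps: "\<iota> (x + y) = \<iota> x + \<iota> y" "\<iota> (c *\<^sub>C x) = c *\<^sub>C \<iota> x" "cinner (\<iota> x) (\<iota> y) = cinner x y"
    for x y c
    using \<iota> by (simp_all add: is_completion_def clinear_def)
  obtain U V where UV: "is_adjoint U V" "V \<circ> U = id" "U \<circ> V = id"
    and gen: "\<And>j k x. \<rho> (ugen j k) x = U (axis k x) $ j"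
      "\<And>j k x. \<rho> ((ugen j k)\<^sup>\<star>) x = V (axis j x) $ k"
    by (rule schuermann_triple_unitary[OF triple]) (rule that; assumption)
  define E where "E a T \<longleftrightarrow> continuous_on UNIV T \<and> (\<forall>x. T (\<iota> x) = \<iota> (\<rho> a x))" for a T
  have "(\<exists>T. E a T) \<and> (\<exists>T. E (a\<^sup>\<star>) T)" for a
  proof (induction a rule: U_alg_induct)
    case (ugen j k)
    have "norm (\<rho> (ugen j k) x) \<le> norm x" for x
      using Finite_Cartesian_Product.norm_nth_le[of "U (axis k x)" j] norm_isometry[OF UV(1,2)] by (simp add: gen norm_axis)
    moreover have "norm (\<rho> ((ugen j k)\<^sup>\<star>) x) \<le> norm x" for x
      using Finite_Cartesian_Product.norm_nth_le[of "V (axis j x)" k] norm_isometry[OF is_adjoint_sym[OF UV(1)] UV(3)]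
      by (simp add: gen norm_axis)
    ultimately show ?case
      unfolding E_def using completion_extend_contraction[OF \<iota> lin] by blast
  next
    case zero
    have "\<iota> 0 = 0"
      using \<iota> clinear_zero by (auto simp: is_completion_def)
    then have "E 0 (\<lambda>_. 0)"
      using D(3)[of 0 0] by (simp add: E_def scaleC_zero_left fun_eq_iff)
    then show ?case by (auto simp: star_zero)
  next
    case one
    have "E 1 (\<lambda>x. x)" by (simp add: E_def D(4))
    then show ?case by (auto simp: star_one)
  next
    case (add a b)
    have "E (a + b) (\<lambda>x. T x + S x)" if "E a T" "E b S" for a b T S
      using that by (auto simp: E_def D(2) \<iota>_simps intro: continuous_on_add)
    with add show ?case unfolding star_add by blast
  next
    case (scaleC c a)
    have "E (c *\<^sub>C a) (\<lambda>x. c *\<^sub>C T x)" if "E a T" for a c T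
      using that by (auto simp: E_def D(3) \<iota>_simps intro: continuous_on_scaleC)
    with scaleC show ?case unfolding star_scaleC by blast
  next
    case (mult a b)
    have "E (a * b) (\<lambda>x. T (S x))" if "E a T" "E b S" for a b T S
      using that by (auto simp: E_def D(5) intro: continuous_on_compose2)
    with mult show ?case unfolding star_mult by blast
  next
    case (star a)
    then show ?case by (simp add: star_star)
  qed
  then obtain \<rho>' where "\<And>a. E a (\<rho>' a)" by metis
  then have cont: "continuous_on UNIV (\<rho>' a)" and ext: "\<rho>' a (\<iota> x) = \<iota> (\<rho> a x)" for a x
    by (simp_all add: E_def)
  note cont_intros = cont continuous_on_scaleC continuous_on_cinner continuous_on_add
    continuous_on_id continuous_on_const continuous_on_compose2[OF cont]
  have "cinner (\<rho>' (a\<^sup>\<star>) y) x = cinner y (\<rho>' a x)" for a x y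
  proof (rule completion_ext[OF \<iota>, of "\<lambda>y. cinner (\<rho>' (a\<^sup>\<star>) y) x" "\<lambda>y. cinner y (\<rho>' a x)"])
    fix w
    show "cinner (\<rho>' (a\<^sup>\<star>) (\<iota> w)) x = cinner (\<iota> w) (\<rho>' a x)"
      by (rule completion_ext[OF \<iota>, of "\<lambda>x. cinner (\<rho>' (a\<^sup>\<star>) (\<iota> w)) x"])
         (use D(6) in \<open>auto intro!: cont_intros simp: ext \<iota>_simps is_adjoint_def\<close>)
  qed (auto intro!: cont_intros)
  then have adj: "is_adjoint (\<rho>' a) (\<rho>' (a\<^sup>\<star>))" for a
    by (simp add: is_adjoint_def)
  have "\<rho>' (a + b) x = \<rho>' a x + \<rho>' b x" for a b x
    by (rule completion_ext[OF \<iota>]) (auto intro!: cont_intros simp: ext D(2) \<iota>_simps)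
  moreover have "\<rho>' (c *\<^sub>C a) x = c *\<^sub>C \<rho>' a x" for c a x
    by (rule completion_ext[OF \<iota>]) (auto intro!: cont_intros simp: ext D(3) \<iota>_simps)
  moreover have "\<rho>' 1 x = x" for x
    by (rule completion_ext[OF \<iota>]) (auto intro!: cont_intros simp: ext D(4))
  moreover have "\<rho>' (a * b) x = \<rho>' a (\<rho>' b x)" for a b x
    by (rule completion_ext[OF \<iota>]) (auto intro!: cont_intros simp: ext D(5))
  ultimately have "star_representation \<rho>'"
    unfolding star_representation_def
    using adj_eqI[OF adj] is_adjoint_adjointable[OF adj] by (auto simp: fun_eq_iff)
  then have "schuermann_triple \<rho>' (\<lambda>a. \<iota> (\<eta> a)) L"
    using triple unfolding schuermann_triple_def by (auto simp: clinear_def ext \<iota>_simps)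
  moreover have "extends_along \<iota> \<rho> \<eta> \<rho>' (\<lambda>a. \<iota> (\<eta> a))"
    by (simp add: extends_along_def ext)
  ultimately show ?thesis by blast
qed

theorem theorem8p3p3:
  shows "(\<forall>(U :: ('h::complex_hilbert) ^ 'd \<Rightarrow> 'h ^ 'd) (A :: 'h ^ 'd ^ 'd) (\<Lambda> :: complex ^ 'd ^ 'd).
           unitary U \<and> hermitian \<Lambda> \<longrightarrow>
           (\<exists>!t. case t of (\<rho>, \<eta>, L) \<Rightarrow>
              schuermann_triple \<rho> \<eta> L \<and> has_parameters \<rho> \<eta> L U A \<Lambda>))
       \<and> (\<forall>(\<rho> :: 'd::finite U_alg \<Rightarrow> ('p::complex_inner) \<Rightarrow> 'p) \<eta> L (\<iota> :: 'p \<Rightarrow> 'h).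
           schuermann_triple \<rho> \<eta> L \<and> is_completion \<iota> \<longrightarrow>
           (\<exists>(U :: 'h ^ 'd \<Rightarrow> 'h ^ 'd) A \<Lambda> \<rho>' \<eta>'.
              unitary U \<and> hermitian \<Lambda> \<and>
              schuermann_triple \<rho>' \<eta>' L \<and> has_parameters \<rho>' \<eta>' L U A \<Lambda> \<and>
              extends_along \<iota> \<rho> \<eta> \<rho>' \<eta>'))"
proof (intro conjI allI impI; elim conjE)
  fix U :: "'h ^ 'd \<Rightarrow> 'h ^ 'd" and A :: "'h ^ 'd ^ 'd" and \<Lambda> :: "complex ^ 'd ^ 'd"
  assume "unitary U" "hermitian \<Lambda>"
  then show "\<exists>!t. case t of (\<rho>, \<eta>, L) \<Rightarrow>
      schuermann_triple \<rho> \<eta> L \<and> has_parameters \<rho> \<eta> L U A \<Lambda>"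
    by (rule schuermann_triple_ex1)
next
  fix \<rho> :: "'d U_alg \<Rightarrow> 'p \<Rightarrow> 'p" and \<eta> L and \<iota> :: "'p \<Rightarrow> 'h"
  assume "schuermann_triple \<rho> \<eta> L" "is_completion \<iota>"
  then obtain \<rho>' \<eta>' where ext: "schuermann_triple \<rho>' \<eta>' L" "extends_along \<iota> \<rho> \<eta> \<rho>' \<eta>'"
    using schuermann_triple_extends by blast
  from schuermann_triple_parameters[OF ext(1)] ext
  show "\<exists>(U :: 'h ^ 'd \<Rightarrow> 'h ^ 'd) A \<Lambda> \<rho>' \<eta>'.
      unitary U \<and> hermitian \<Lambda> \<and> schuermann_triple \<rho>' \<eta>' L \<and> has_parameters \<rho>' \<eta>' L U A \<Lambda> \<and>
      extends_along \<iota> \<rho> \<eta> \<rho>' \<eta>'"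
    by blast
qed

end
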